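(* Let $x,y,z,t$ be positive integers with $x^2+y^2+z^2=t^2$ (so that at least two of $x,y,z$ are even). Let $D$ be a positive integer, where $D$ is arbitrary if all three of $x,y,z$ are even, and $D$ is even if exactly two of $x,y,z$ are even and the third is odd. Then any triangle with integer side lengths $$a=\frac{D(y^2+z^2)}{2},\qquad b=\frac{D(x^2+z^2)}{2},\qquad c=\frac{D(x^2+y^2)}{2}$$ has rational area.
   Context: "Area" is the usual Euclidean area of the (nondegenerate) triangle with the given side lengths. *)

theory Defs
  imports "HOL-Analysis.Analysis"
begin

definition triangle_with_sides ::
  "real ^ 2 \<Rightarrow> real ^ 2 \<Rightarrow> real ^ 2 \<Rightarrow> real \<Rightarrow> real \<Rightarrow> real \<Rightarrow> bool" where
  "triangle_with_sides A B C a b c \<longleftrightarrow>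
     \<not> collinear {A, B, C} \<and> dist B C = a \<and> dist A C = b \<and> dist A B = c"

definition triangle_area :: "real ^ 2 \<Rightarrow> real ^ 2 \<Rightarrow> real ^ 2 \<Rightarrow> real" where
  "triangle_area A B C = measure lborel (convex hull {A, B, C})"

end

theory Submission
  imports Defs
begin

text \<open>
  Since \<open>a + b + c = D (x\<^sup>2 + y\<^sup>2 + z\<^sup>2) = D t\<^sup>2\<close>, the semiperimeter is \<open>s = D t\<^sup>2 / 2\<close>, and the
  factors in Heron's formula become \<open>s - a = D x\<^sup>2 / 2\<close>, \<open>s - b = D y\<^sup>2 / 2\<close> and
  \<open>s - c = D z\<^sup>2 / 2\<close>: the sides are the pairwise sums of \<open>D x\<^sup>2 / 2\<close>, \<open>D y\<^sup>2 / 2\<close> and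
  \<open>D z\<^sup>2 / 2\<close>. Each of the four factors is \<open>D / 2\<close> times a square, so the radicand is the square of
  \<open>D\<^sup>2 x y z t / 4\<close>, which is therefore the area.

  The parity claim is an obstruction modulo 4. It leaves two cases for integrality: either all of
  \<open>x\<close>, \<open>y\<close>, \<open>z\<close> are even and every sum of two squares is even, or exactly two are even, and then
  \<open>D\<close> is.
\<close>

text \<open>
  Squares are 0 or 1 modulo 4, so a sum of three squares, two of them odd, is 2 or 3 modulo 4.
\<close>

lemma sum_three_squares_two_odd_not_square:
  fixes x y z t :: nat
  assumes "odd x" and "odd y"
  shows "x\<^sup>2 + y\<^sup>2 + z\<^sup>2 \<noteq> t\<^sup>2"
proof
  assume eq: "x\<^sup>2 + y\<^sup>2 + z\<^sup>2 = t\<^sup>2"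
  have sq: "n\<^sup>2 mod 4 = (if odd n then 1 else 0)" for n :: nat
  proof (cases "even n")
    case True
    then show ?thesis by (auto elim!: evenE simp: power_mult_distrib)
  next
    case False
    then obtain k where "n = 2 * k + 1" by (auto elim: oddE)
    then have "n\<^sup>2 = 1 + 4 * (k * k + k)" by (simp add: power2_eq_square algebra_simps)
    then have "n\<^sup>2 mod 4 = 1" by presburger
    then show ?thesis using False by simp
  qed
  have "t\<^sup>2 mod 4 = (x\<^sup>2 mod 4 + y\<^sup>2 mod 4 + z\<^sup>2 mod 4) mod 4"
    unfolding eq [symmetric] by (intro mod_add_cong) simp_all
  then show False using assms by (auto simp: sq split: if_splits)
qed

lemma half_of_even_in_Ints:
  fixes n :: nat
  assumes "even n"
  shows "real n / 2 \<in> \<int>"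
  using assms by (auto elim!: evenE)

text \<open>
  The case of Heron's formula in which the three factors \<open>s - a\<close>, \<open>s - b\<close>, \<open>s - c\<close> and \<open>s\<close> itself
  are \<open>k u\<^sup>2\<close>, \<open>k v\<^sup>2\<close>, \<open>k w\<^sup>2\<close> and \<open>k t\<^sup>2\<close> for one constant \<open>k\<close>, so that the root can be extracted.
\<close>

lemma triangle_area_sides_sums_of_squares:
  fixes A B C :: "real ^ 2" and k u v w t :: real
  assumes "dist B C = k * (v\<^sup>2 + w\<^sup>2)"
    and "dist A C = k * (u\<^sup>2 + w\<^sup>2)"
    and "dist A B = k * (u\<^sup>2 + v\<^sup>2)"
    and "u\<^sup>2 + v\<^sup>2 + w\<^sup>2 = t\<^sup>2"
  shows "triangle_area A B C = \<bar>k\<^sup>2 * u * v * w * t\<bar>"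
proof -
  define s where "s = (dist B C + dist A C + dist A B) / 2"
  have s: "s = k * (u\<^sup>2 + v\<^sup>2 + w\<^sup>2)"
    by (simp add: s_def assms(1-3) algebra_simps)
  have diffs: "s - dist B C = k * u\<^sup>2" "s - dist A C = k * v\<^sup>2" "s - dist A B = k * w\<^sup>2"
    by (simp_all add: s assms(1-3) algebra_simps)
  have "triangle_area A B C = sqrt (s * (s - dist B C) * (s - dist A C) * (s - dist A B))"
    unfolding triangle_area_def s_def by (rule heron)
  also have "\<dots> = sqrt ((k * t\<^sup>2) * (k * u\<^sup>2) * (k * v\<^sup>2) * (k * w\<^sup>2))"
    by (simp only: diffs) (simp only: s assms(4))
  also have "\<dots> = sqrt ((k\<^sup>2 * u * v * w * t)\<^sup>2)"
    by (simp add: power2_eq_square mult_ac)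
  finally show ?thesis by simp
qed

theorem mainTheorem1:
  fixes x y z t D :: nat and a b c :: real
  assumes "x > 0" and "y > 0" and "z > 0" and "t > 0"
    and "x\<^sup>2 + y\<^sup>2 + z\<^sup>2 = t\<^sup>2"
    and "D > 0"
    and "(even x \<and> even y \<and> odd z) \<or> (even x \<and> odd y \<and> even z) \<or> (odd x \<and> even y \<and> even z)
           \<Longrightarrow> even D"
    and "a = real D * (real y ^ 2 + real z ^ 2) / 2"
    and "b = real D * (real x ^ 2 + real z ^ 2) / 2"
    and "c = real D * (real x ^ 2 + real y ^ 2) / 2"
  shows "((even x \<and> even y) \<or> (even x \<and> even z) \<or> (even y \<and> even z))
       \<and> a \<in> \<int> \<and> b \<in> \<int> \<and> c \<in> \<int>
       \<and> (\<forall>A B C. triangle_with_sides A B C a b c \<longrightarrow> triangle_area A B C \<in> \<rat>)"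
proof -
  have "even x \<or> even y" "even x \<or> even z" "even y \<or> even z"
    using sum_three_squares_two_odd_not_square[of x y z t]
      sum_three_squares_two_odd_not_square[of x z y t]
      sum_three_squares_two_odd_not_square[of y z x t] assms(5)
    by (auto simp: add_ac)
  then have two_even: "(even x \<and> even y) \<or> (even x \<and> even z) \<or> (even y \<and> even z)"
    by blast
  then have "even D \<or> (even x \<and> even y \<and> even z)"
    using assms(7) by blast
  then have "even (D * (y\<^sup>2 + z\<^sup>2))" "even (D * (x\<^sup>2 + z\<^sup>2))" "even (D * (x\<^sup>2 + y\<^sup>2))"
    by auto
  from this[THEN half_of_even_in_Ints] have ints: "a \<in> \<int>" "b \<in> \<int>" "c \<in> \<int>"
    by (simp_all add: assms(8-10))
  have "triangle_area A B C \<in> \<rat>" if "triangle_with_sides A B C a b c" for A B C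
  proof -
    have sum: "(real x)\<^sup>2 + (real y)\<^sup>2 + (real z)\<^sup>2 = (real t)\<^sup>2"
      using arg_cong[OF assms(5), of real] by simp
    have "triangle_area A B C = \<bar>(real D / 2)\<^sup>2 * real x * real y * real z * real t\<bar>"
      using that sum
      by (intro triangle_area_sides_sums_of_squares)
         (simp_all add: triangle_with_sides_def assms(8-10))
    also have "\<dots> \<in> \<rat>"
      by simp
    finally show ?thesis .
  qed
  with two_even ints show ?thesis by blast
qed

end
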